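(* Let $\alpha > -1$ be a real number and let $M = (C^{(\alpha)},3) \in \mathcal{B}(\ell^2)$ be the generalized Cesàro matrix of order three, i.e. the operator on $\ell^2$ given by the lower triangular infinite matrix $[m_{ij}]_{i,j \geq 0}$ with \[ m_{ij} = \begin{cases} \dfrac{3(i+1-j)(i+2-j)}{(i+1+\alpha)(i+2+\alpha)(i+3+\alpha)} & \text{for } 0 \leq j \leq i, \\ 0 & \text{for } j > i. \end{cases} \] Then $M$ is both posinormal and coposinormal.
   Context: $\ell^2$ is the Hilbert space of square-summable sequences indexed by $n = 0,1,2,\dots$, and infinite matrices act on it with respect to the standard orthonormal basis, so $(Mf)_i = \sum_{j} m_{ij} f_j$. For a Hilbert space $H$, $\mathcal{B}(H)$ denotes the set of bounded linear operators on $H$. The matrix $M$ defines a bounded operator on $\ell^2$ for all $\alpha > -1$. An operator $A \in \mathcal{B}(H)$ is posinormal if there exists a positive (i.e. positive semidefinite) operator $P \in \mathcal{B}(H)$ such that $AA^* = A^*PA$; it is coposinormal if there exists a positive operator $Q \in \mathcal{B}(H)$ such that $AQA^* = A^*A$. *)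

theory Defs
  imports "HOL-Analysis.Analysis"
begin

section \<open>Operators on complex Hilbert spaces\<close>

text \<open>A complex Hilbert space is rendered as a complete real inner product space with a
  compatible complex structure: the real inner product of the library is the real part of
  the complex one, so the norm is the one induced by \<^term>\<open>cinner\<close>. The complex inner
  product is linear in its first argument.\<close>

class complex_hilbert_space = real_inner + banach +
  fixes scaleC :: "complex \<Rightarrow> 'a \<Rightarrow> 'a" (infixr "*\<^sub>C" 75)
    and cinner :: "'a \<Rightarrow> 'a \<Rightarrow> complex"
  assumes scaleC_add_right: "c *\<^sub>C (x + y) = c *\<^sub>C x + c *\<^sub>C y"
    and scaleC_add_left: "(c + d) *\<^sub>C x = c *\<^sub>C x + d *\<^sub>C x"
    and scaleC_scaleC: "c *\<^sub>C (d *\<^sub>C x) = (c * d) *\<^sub>C x"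
    and scaleC_of_real: "complex_of_real r *\<^sub>C x = r *\<^sub>R x"
    and cinner_add_left: "cinner (x + y) z = cinner x z + cinner y z"
    and cinner_scaleC_left: "cinner (c *\<^sub>C x) y = c * cinner x y"
    and cinner_commute: "cinner x y = cnj (cinner y x)"
    and Re_cinner: "Re (cinner x y) = x \<bullet> y"

definition bounded_clinear :: "('a::complex_hilbert_space \<Rightarrow> 'a) \<Rightarrow> bool" where
  "bounded_clinear A \<longleftrightarrow> bounded_linear A \<and> (\<forall>c x. A (c *\<^sub>C x) = c *\<^sub>C A x)"

text \<open>Meaningful for bounded \<open>A\<close>, where the adjoint exists by the Riesz representation theorem.\<close>

definition cadjoint :: "('a::complex_hilbert_space \<Rightarrow> 'a) \<Rightarrow> 'a \<Rightarrow> 'a" where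
  "cadjoint A = (THE B. \<forall>x y. cinner (A x) y = cinner x (B y))"

lemma cadjoint_eqI:
  fixes A B :: "'a::complex_hilbert_space \<Rightarrow> 'a"
  assumes "\<And>x y. cinner (A x) y = cinner x (B y)"
  shows "cadjoint A = B"
  unfolding cadjoint_def
proof (rule the_equality)
  fix C assume C: "\<forall>x y. cinner (A x) y = cinner x (C y)"
  show "C = B"
  proof
    fix y
    have "x \<bullet> C y = x \<bullet> B y" for x
      using C assms by (metis Re_cinner)
    then show "C y = B y" using vector_eq_ldot by blast
  qed
qed (use assms in blast)

definition positive_operator :: "('a::complex_hilbert_space \<Rightarrow> 'a) \<Rightarrow> bool" where
  "positive_operator P \<longleftrightarrow> bounded_clinear P \<and> (\<forall>x. cinner (P x) x \<in> \<real>\<^sub>\<ge>\<^sub>0)"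

definition posinormal :: "('a::complex_hilbert_space \<Rightarrow> 'a) \<Rightarrow> bool" where
  "posinormal A \<longleftrightarrow> bounded_clinear A \<and>
     (\<exists>P. positive_operator P \<and> A \<circ> cadjoint A = cadjoint A \<circ> P \<circ> A)"

definition coposinormal :: "('a::complex_hilbert_space \<Rightarrow> 'a) \<Rightarrow> bool" where
  "coposinormal A \<longleftrightarrow> bounded_clinear A \<and>
     (\<exists>Q. positive_operator Q \<and> A \<circ> Q \<circ> cadjoint A = cadjoint A \<circ> A)"


section \<open>The Hilbert space of square-summable sequences\<close>

typedef ell2 = "{f :: nat \<Rightarrow> complex. summable (\<lambda>n. (cmod (f n))\<^sup>2)}"
  morphisms ell2_nth Abs_ell2
  by (rule exI[of _ "\<lambda>_. 0"]) simp

setup_lifting type_definition_ell2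

lemma ell2_eqI: "(\<And>n. ell2_nth x n = ell2_nth y n) \<Longrightarrow> x = y"
  by (intro ell2_nth_inject[THEN iffD1] ext)

lemma summable_ell2: "summable (\<lambda>n. (cmod (ell2_nth x n))\<^sup>2)"
  using ell2_nth[of x] by simp

lemma summable_norm_mult:
  fixes f g :: "nat \<Rightarrow> complex"
  assumes "summable (\<lambda>n. (cmod (f n))\<^sup>2)" "summable (\<lambda>n. (cmod (g n))\<^sup>2)"
  shows "summable (\<lambda>n. cmod (f n) * cmod (g n))"
proof (rule summable_comparison_test'[of _ 0])
  show "summable (\<lambda>n. (cmod (f n))\<^sup>2 + (cmod (g n))\<^sup>2)"
    using assms by (rule summable_add)
  show "norm (cmod (f n) * cmod (g n)) \<le> (cmod (f n))\<^sup>2 + (cmod (g n))\<^sup>2" for n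
  proof -
    have "2 * cmod (f n) * cmod (g n) \<le> (cmod (f n))\<^sup>2 + (cmod (g n))\<^sup>2"
      by (rule sum_squares_bound)
    moreover have "0 \<le> cmod (f n) * cmod (g n)" by simp
    ultimately show ?thesis unfolding real_norm_def by linarith
  qed
qed

lemma summable_norm_add:
  fixes f g :: "nat \<Rightarrow> complex"
  assumes "summable (\<lambda>n. (cmod (f n))\<^sup>2)" "summable (\<lambda>n. (cmod (g n))\<^sup>2)"
  shows "summable (\<lambda>n. (cmod (f n + g n))\<^sup>2)"
proof (rule summable_comparison_test'[of _ 0])
  show "summable (\<lambda>n. (cmod (f n))\<^sup>2 + (cmod (g n))\<^sup>2 + 2 * (cmod (f n) * cmod (g n)))"
    by (intro summable_add summable_mult summable_norm_mult assms)
  show "norm ((cmod (f n + g n))\<^sup>2) \<le> (cmod (f n))\<^sup>2 + (cmod (g n))\<^sup>2 + 2 * (cmod (f n) * cmod (g n))" for n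
    using power_mono[OF norm_triangle_ineq[of "f n" "g n"], of 2]
    by (simp add: power2_sum)
qed

lemma summable_ell2_mult: "summable (\<lambda>n. ell2_nth x n * cnj (ell2_nth y n))"
proof (rule summable_norm_cancel)
  show "summable (\<lambda>n. norm (ell2_nth x n * cnj (ell2_nth y n)))"
    unfolding norm_mult complex_mod_cnj by (intro summable_norm_mult summable_ell2)
qed

instantiation ell2 :: real_inner
begin

lift_definition zero_ell2 :: ell2 is "\<lambda>_. 0" by simp

lift_definition plus_ell2 :: "ell2 \<Rightarrow> ell2 \<Rightarrow> ell2" is "\<lambda>f g n. f n + g n"
  by (rule summable_norm_add)

lift_definition uminus_ell2 :: "ell2 \<Rightarrow> ell2" is "\<lambda>f n. - f n" by simp

definition minus_ell2 :: "ell2 \<Rightarrow> ell2 \<Rightarrow> ell2" where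
  "minus_ell2 x y = x + - y"

lift_definition scaleR_ell2 :: "real \<Rightarrow> ell2 \<Rightarrow> ell2" is "\<lambda>r f n. complex_of_real r * f n"
  by (simp add: norm_mult power_mult_distrib summable_mult)

definition inner_ell2 :: "ell2 \<Rightarrow> ell2 \<Rightarrow> real" where
  "inner_ell2 x y = Re (\<Sum>n. ell2_nth x n * cnj (ell2_nth y n))"

definition norm_ell2 :: "ell2 \<Rightarrow> real" where
  "norm_ell2 x = sqrt (x \<bullet> x)"

definition dist_ell2 :: "ell2 \<Rightarrow> ell2 \<Rightarrow> real" where
  "dist_ell2 x y = norm (x - y)"

definition sgn_ell2 :: "ell2 \<Rightarrow> ell2" where
  "sgn_ell2 x = inverse (norm x) *\<^sub>R x"

definition uniformity_ell2 :: "(ell2 \<times> ell2) filter" where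
  "uniformity_ell2 = (INF e\<in>{0<..}. principal {(x, y). dist x y < e})"

definition open_ell2 :: "ell2 set \<Rightarrow> bool" where
  "open_ell2 U \<longleftrightarrow> (\<forall>x\<in>U. \<forall>\<^sub>F (x', y) in uniformity. x' = x \<longrightarrow> y \<in> U)"

lemma inner_ell2_self: "x \<bullet> x = (\<Sum>n. (cmod (ell2_nth x n))\<^sup>2)" for x :: ell2
proof -
  have "(\<Sum>n. ell2_nth x n * cnj (ell2_nth x n)) = complex_of_real (\<Sum>n. (cmod (ell2_nth x n))\<^sup>2)"
    using summable_ell2[of x]
    by (simp add: suminf_of_real complex_norm_square flip: of_real_power)
  then show ?thesis by (simp add: inner_ell2_def)
qed

instance
proof
  fix x y z :: ell2 and a b r :: real
  show "x + y + z = x + (y + z)" "x + y = y + x" "0 + x = x" "- x + x = 0"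
    "a *\<^sub>R (x + y) = a *\<^sub>R x + a *\<^sub>R y" "(a + b) *\<^sub>R x = a *\<^sub>R x + b *\<^sub>R x"
    "a *\<^sub>R b *\<^sub>R x = (a * b) *\<^sub>R x" "1 *\<^sub>R x = x"
    by (transfer; simp add: algebra_simps)+
  show "x - y = x + - y" by (rule minus_ell2_def)
  show "dist x y = norm (x - y)" by (rule dist_ell2_def)
  show "sgn x = inverse (norm x) *\<^sub>R x" by (rule sgn_ell2_def)
  show "uniformity = (INF e\<in>{0<..}. principal {(x :: ell2, y). dist x y < e})"
    by (rule uniformity_ell2_def)
  show "open U \<longleftrightarrow> (\<forall>x\<in>U. \<forall>\<^sub>F (x', y) in uniformity. x' = x \<longrightarrow> y \<in> U)" for U :: "ell2 set"
    by (rule open_ell2_def)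
  show "norm x = sqrt (x \<bullet> x)" by (rule norm_ell2_def)
  show "x \<bullet> y = y \<bullet> x"
  proof -
    have "(\<Sum>n. ell2_nth x n * cnj (ell2_nth y n)) = cnj (\<Sum>n. ell2_nth y n * cnj (ell2_nth x n))"
      by (rule sums_unique[symmetric])
        (use sums_cnj[THEN iffD2, OF summable_sums[OF summable_ell2_mult[of y x]]]
          in \<open>simp add: mult.commute\<close>)
    then show ?thesis by (simp add: inner_ell2_def)
  qed
  show "(x + y) \<bullet> z = x \<bullet> z + y \<bullet> z"
    using suminf_add[OF summable_ell2_mult[of x z] summable_ell2_mult[of y z]]
    by (simp add: inner_ell2_def plus_ell2.rep_eq distrib_right flip: plus_complex.sel)
  show "(r *\<^sub>R x) \<bullet> y = r * (x \<bullet> y)"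
    using suminf_mult[OF summable_ell2_mult[of x y], of "complex_of_real r"]
    by (simp add: inner_ell2_def scaleR_ell2.rep_eq mult.assoc)
  show "0 \<le> x \<bullet> x"
    by (simp add: inner_ell2_self suminf_nonneg summable_ell2)
  show "x \<bullet> x = 0 \<longleftrightarrow> x = 0"
  proof -
    have "x = 0 \<longleftrightarrow> (\<forall>n. ell2_nth x n = 0)"
      by (metis ell2_eqI zero_ell2.rep_eq)
    then show ?thesis
      using suminf_eq_zero_iff[OF summable_ell2[of x]] by (simp add: inner_ell2_self)
  qed
qed

end

lemma ell2_nth_diff: "ell2_nth (x - y) n = ell2_nth x n - ell2_nth y n"
  unfolding minus_ell2_def plus_ell2.rep_eq uminus_ell2.rep_eq by simp

lemma norm_ell2_square: "(norm x)\<^sup>2 = (\<Sum>n. (cmod (ell2_nth x n))\<^sup>2)" for x :: ell2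
  by (simp add: power2_norm_eq_inner inner_ell2_self)

lemma sum_le_norm_ell2:
  fixes x :: ell2 and N :: nat
  shows "(\<Sum>n<N. (cmod (ell2_nth x n))\<^sup>2) \<le> (norm x)\<^sup>2"
  unfolding norm_ell2_square by (rule sum_le_suminf) (auto simp: summable_ell2)

lemma cmod_ell2_nth_le: "cmod (ell2_nth x n) \<le> norm x"
proof -
  have "(cmod (ell2_nth x n))\<^sup>2 \<le> (\<Sum>k<Suc n. (cmod (ell2_nth x k))\<^sup>2)"
    by (simp add: sum_nonneg)
  also have "\<dots> \<le> (norm x)\<^sup>2" by (rule sum_le_norm_ell2)
  finally show ?thesis by (rule power2_le_imp_le) simp
qed

text \<open>A sequence whose squared partial sums are bounded lies in the space.\<close>

lemma ell2_Abs:
  fixes f :: "nat \<Rightarrow> complex"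
  assumes b: "\<And>N. (\<Sum>n<N. (cmod (f n))\<^sup>2) \<le> K\<^sup>2" and K: "0 \<le> K"
  shows "ell2_nth (Abs_ell2 f) = f" "norm (Abs_ell2 f) \<le> K"
proof -
  have s: "summable (\<lambda>n. (cmod (f n))\<^sup>2)"
    by (rule summableI_nonneg_bounded[OF _ b]) simp
  then show eq: "ell2_nth (Abs_ell2 f) = f"
    by (simp add: Abs_ell2_inverse)
  have "(norm (Abs_ell2 f))\<^sup>2 \<le> K\<^sup>2"
    unfolding norm_ell2_square eq by (rule suminf_le_const[OF s b])
  then show "norm (Abs_ell2 f) \<le> K" using K by (rule power2_le_imp_le)
qed

instance ell2 :: complete_space
proof
  fix X :: "nat \<Rightarrow> ell2" assume X: "Cauchy X"
  have "Cauchy (\<lambda>k. ell2_nth (X k) n)" for n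
  proof (rule metric_CauchyI)
    fix e :: real assume "e > 0"
    then obtain M where "\<forall>k\<ge>M. \<forall>m\<ge>M. dist (X k) (X m) < e"
      using X by (meson metric_CauchyD)
    then show "\<exists>M. \<forall>k\<ge>M. \<forall>m\<ge>M. dist (ell2_nth (X k) n) (ell2_nth (X m) n) < e"
      by (metis cmod_ell2_nth_le dist_norm ell2_nth_diff order_le_less_trans)
  qed
  then have "\<forall>n. \<exists>l. (\<lambda>k. ell2_nth (X k) n) \<longlonglongrightarrow> l"
    by (simp add: Cauchy_convergent_iff convergent_def)
  then obtain f where f: "\<And>n. (\<lambda>k. ell2_nth (X k) n) \<longlonglongrightarrow> f n" by metis
  have close: "\<exists>M. \<forall>k\<ge>M. \<forall>N. (\<Sum>n<N. (cmod (ell2_nth (X k) n - f n))\<^sup>2) \<le> e\<^sup>2" if "e > 0" for e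
  proof -
    obtain M where M: "\<And>k m. k \<ge> M \<Longrightarrow> m \<ge> M \<Longrightarrow> dist (X k) (X m) < e"
      using X \<open>e > 0\<close> by (meson metric_CauchyD)
    show ?thesis
    proof (intro exI[of _ M] allI impI)
      fix k N assume k: "k \<ge> M"
      show "(\<Sum>n<N. (cmod (ell2_nth (X k) n - f n))\<^sup>2) \<le> e\<^sup>2"
      proof (rule LIMSEQ_le_const2)
        show "(\<lambda>m. \<Sum>n<N. (cmod (ell2_nth (X k) n - ell2_nth (X m) n))\<^sup>2)
            \<longlonglongrightarrow> (\<Sum>n<N. (cmod (ell2_nth (X k) n - f n))\<^sup>2)"
          by (intro tendsto_intros f)
        show "\<exists>M. \<forall>m\<ge>M. (\<Sum>n<N. (cmod (ell2_nth (X k) n - ell2_nth (X m) n))\<^sup>2) \<le> e\<^sup>2"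
        proof (intro exI[of _ M] allI impI)
          fix m assume "m \<ge> M"
          then have "norm (X k - X m) \<le> e"
            using M[OF k, of m] by (simp add: dist_norm)
          then have "(norm (X k - X m))\<^sup>2 \<le> e\<^sup>2" by (simp add: power_mono)
          then show "(\<Sum>n<N. (cmod (ell2_nth (X k) n - ell2_nth (X m) n))\<^sup>2) \<le> e\<^sup>2"
            using sum_le_norm_ell2[of "X k - X m" N] by (simp add: ell2_nth_diff)
        qed
      qed
    qed
  qed
  obtain M where M: "\<And>N. (\<Sum>n<N. (cmod (ell2_nth (X M) n - f n))\<^sup>2) \<le> 1\<^sup>2"
    using close[of 1] by auto
  define g where "g = Abs_ell2 (\<lambda>n. ell2_nth (X M) n - f n)"
  have g: "ell2_nth g n = ell2_nth (X M) n - f n" for n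
    unfolding g_def using ell2_Abs(1)[OF M] by simp
  define L where "L = X M - g"
  have L: "ell2_nth L n = f n" for n by (simp add: L_def ell2_nth_diff g)
  have "X \<longlonglongrightarrow> L"
  proof (rule metric_LIMSEQ_I)
    fix e :: real assume "e > 0"
    then obtain M where M: "\<And>k N. k \<ge> M \<Longrightarrow> (\<Sum>n<N. (cmod (ell2_nth (X k) n - f n))\<^sup>2) \<le> (e/2)\<^sup>2"
      using close[of "e/2"] by auto
    show "\<exists>M. \<forall>k\<ge>M. dist (X k) L < e"
    proof (intro exI[of _ M] allI impI)
      fix k assume k: "k \<ge> M"
      have "norm (X k - L) \<le> e / 2"
        using ell2_Abs(2)[of "ell2_nth (X k - L)" "e/2"] M[OF k] \<open>e > 0\<close>
        by (simp add: ell2_nth_diff L ell2_nth_inverse)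
      then show "dist (X k) L < e" using \<open>e > 0\<close> by (simp add: dist_norm)
    qed
  qed
  then show "convergent X" by (rule convergentI)
qed

instance ell2 :: banach ..

instantiation ell2 :: complex_hilbert_space
begin

lift_definition scaleC_ell2 :: "complex \<Rightarrow> ell2 \<Rightarrow> ell2" is "\<lambda>c f n. c * f n"
  by (simp add: norm_mult power_mult_distrib summable_mult)

definition cinner_ell2 :: "ell2 \<Rightarrow> ell2 \<Rightarrow> complex" where
  "cinner_ell2 x y = (\<Sum>n. ell2_nth x n * cnj (ell2_nth y n))"

instance
proof
  fix x y z :: ell2 and c d :: complex and r :: real
  show "c *\<^sub>C (x + y) = c *\<^sub>C x + c *\<^sub>C y" "(c + d) *\<^sub>C x = c *\<^sub>C x + d *\<^sub>C x"
    "c *\<^sub>C (d *\<^sub>C x) = (c * d) *\<^sub>C x" "complex_of_real r *\<^sub>C x = r *\<^sub>R x"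
    by (transfer; simp add: algebra_simps)+
  show "cinner (x + y) z = cinner x z + cinner y z"
    using suminf_add[OF summable_ell2_mult[of x z] summable_ell2_mult[of y z]]
    by (simp add: cinner_ell2_def plus_ell2.rep_eq distrib_right)
  show "cinner (c *\<^sub>C x) y = c * cinner x y"
    using suminf_mult[OF summable_ell2_mult[of x y], of c]
    by (simp add: cinner_ell2_def scaleC_ell2.rep_eq mult.assoc)
  show "cinner x y = cnj (cinner y x)"
    unfolding cinner_ell2_def
    by (rule sums_unique[symmetric])
      (use sums_cnj[THEN iffD2, OF summable_sums[OF summable_ell2_mult[of y x]]]
        in \<open>simp add: mult.commute\<close>)
  show "Re (cinner x y) = x \<bullet> y"
    by (simp add: cinner_ell2_def inner_ell2_def)
qed

end


section \<open>Matrix operators and the generalized Cesaro matrix of order three\<close>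

text \<open>Only meaningful when the matrix maps the space into itself, as otherwise \<^term>\<open>Abs_ell2\<close>
  is applied outside its domain.\<close>

definition matrix_operator :: "(nat \<Rightarrow> nat \<Rightarrow> complex) \<Rightarrow> ell2 \<Rightarrow> ell2" where
  "matrix_operator m f = Abs_ell2 (\<lambda>i. \<Sum>j. m i j * ell2_nth f j)"

definition cesaro3_matrix :: "real \<Rightarrow> nat \<Rightarrow> nat \<Rightarrow> real" where
  "cesaro3_matrix \<alpha> i j =
    (if j \<le> i
     then 3 * (real i + 1 - real j) * (real i + 2 - real j) /
       ((real i + 1 + \<alpha>) * (real i + 2 + \<alpha>) * (real i + 3 + \<alpha>))
     else 0)"

definition cesaro3 :: "real \<Rightarrow> ell2 \<Rightarrow> ell2" where
  "cesaro3 \<alpha> = matrix_operator (\<lambda>i j. complex_of_real (cesaro3_matrix \<alpha> i j))"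

text \<open>Hardy's inequality, used to check that \<^term>\<open>cesaro3 \<alpha>\<close> is well defined and bounded
  for \<open>\<alpha> > -1\<close>.\<close>

lemma hardy_inequality:
  fixes a :: "nat \<Rightarrow> real"
  shows "(\<Sum>n<N. ((\<Sum>k\<le>n. a k) / (real n + 1))\<^sup>2) \<le> 4 * (\<Sum>n<N. (a n)\<^sup>2)"
proof -
  define A where "A n = (\<Sum>k\<le>n. a k) / (real n + 1)" for n
  define B where "B n = (if n = 0 then 0 else A (n - 1))" for n
  have step: "(A n)\<^sup>2 + (real n + 1) * (A n)\<^sup>2 \<le> 2 * (A n * a n) + real n * (B n)\<^sup>2" for n
  proof -
    have nz: "real k + 1 \<noteq> 0" for k by linarith
    have A: "(real k + 1) * A k = (\<Sum>k\<le>k. a k)" for k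
      unfolding A_def using nz[of k] by simp
    have "real n * B n = (\<Sum>k<n. a k)"
    proof (cases n)
      case (Suc m)
      then show ?thesis using A[of m] by (simp add: B_def lessThan_Suc_atMost add.commute)
    qed simp
    then have "(real n + 1) * A n = real n * B n + a n"
      using A[of n] by (simp add: lessThan_Suc_atMost[symmetric])
    then have an: "a n = (real n + 1) * A n - real n * B n" by linarith
    have "2 * (A n * a n) + real n * (B n)\<^sup>2 - ((A n)\<^sup>2 + (real n + 1) * (A n)\<^sup>2)
        = real n * (A n - B n)\<^sup>2"
      unfolding an by (simp add: power2_eq_square algebra_simps)
    moreover have "0 \<le> real n * (A n - B n)\<^sup>2" by simp
    ultimately show ?thesis by linarith
  qed
  have "(\<Sum>n<N. (A n)\<^sup>2) + real N * (B N)\<^sup>2 \<le> 2 * (\<Sum>n<N. A n * a n)"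
  proof (induction N)
    case (Suc N)
    have "real (Suc N) * (B (Suc N))\<^sup>2 = (real N + 1) * (A N)\<^sup>2" by (simp add: B_def)
    then show ?case using Suc step[of N] unfolding sum.lessThan_Suc distrib_left by linarith
  qed simp
  moreover have "0 \<le> real N * (B N)\<^sup>2" by simp
  moreover have "4 * (\<Sum>n<N. A n * a n) \<le> (\<Sum>n<N. (A n)\<^sup>2) + 4 * (\<Sum>n<N. (a n)\<^sup>2)"
  proof -
    have "4 * (A n * a n) \<le> (A n)\<^sup>2 + 4 * (a n)\<^sup>2" for n
      using zero_le_power2[of "A n - 2 * a n"] by (simp add: power2_eq_square algebra_simps)
    then show ?thesis unfolding sum_distrib_left sum.distrib[symmetric] by (intro sum_mono)
  qed
  ultimately show ?thesis unfolding A_def by linarith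
qed

lemma cesaro3_matrix_suminf:
  "(\<Sum>j. complex_of_real (cesaro3_matrix \<alpha> i j) * g j) =
   (\<Sum>j\<le>i. complex_of_real (cesaro3_matrix \<alpha> i j) * g j)"
  by (rule suminf_finite) (auto simp: cesaro3_matrix_def)

lemma cesaro3_matrix_bound:
  assumes "\<alpha> > -1" "j \<le> i"
  shows "\<bar>cesaro3_matrix \<alpha> i j\<bar> \<le> 6 / (min 1 (1 + \<alpha>)) / (real i + 1)"
proof -
  define c where "c = min 1 (1 + \<alpha>)"
  have c: "0 < c" "c \<le> 1" "c \<le> 1 + \<alpha>" using assms by (auto simp: c_def)
  define u v where "u = real i + 1 - real j" and "v = real i + 2 - real j"
  have u: "0 \<le> u" "u \<le> real i + 1" and v: "0 \<le> v" "v \<le> real i + 2"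
    using assms by (auto simp: u_def v_def)
  have d1: "c * (real i + 1) \<le> real i + 1 + \<alpha>"
  proof -
    have "c * real i \<le> real i" using c by (simp add: mult_left_le_one_le)
    then show ?thesis using c by (simp add: algebra_simps)
  qed
  have d2: "real i + 1 \<le> real i + 2 + \<alpha>" and d3: "real i + 2 \<le> 2 * (real i + 3 + \<alpha>)"
    using assms by auto
  have D: "c * (real i + 1) * (real i + 1) * (real i + 2) \<le>
      2 * ((real i + 1 + \<alpha>) * (real i + 2 + \<alpha>) * (real i + 3 + \<alpha>))"
  proof -
    have "(c * (real i + 1)) * (real i + 1) * (real i + 2) \<le>
       (real i + 1 + \<alpha>) * (real i + 2 + \<alpha>) * (2 * (real i + 3 + \<alpha>))"
      using d1 d2 d3 c assms by (intro mult_mono) auto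
    then show ?thesis by (simp add: algebra_simps)
  qed
  have pos: "0 < (real i + 1 + \<alpha>) * (real i + 2 + \<alpha>) * (real i + 3 + \<alpha>)"
    using assms by auto
  have "3 * u * v \<le> 3 * ((real i + 1) * (real i + 2))"
    using mult_mono[of u "real i + 1" v "real i + 2"] u v by simp
  then have "3 * u * v * (c * (real i + 1)) \<le> 3 * ((real i + 1) * (real i + 2)) * (c * (real i + 1))"
    using c by (intro mult_right_mono) auto
  also have "\<dots> \<le> 6 * ((real i + 1 + \<alpha>) * (real i + 2 + \<alpha>) * (real i + 3 + \<alpha>))"
    using D by (simp add: algebra_simps)
  finally have "3 * u * v / ((real i + 1 + \<alpha>) * (real i + 2 + \<alpha>) * (real i + 3 + \<alpha>)) \<le> 6 / c / (real i + 1)"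
    using pos c by (simp add: pos_divide_le_eq pos_le_divide_eq mult.commute mult.left_commute)
  moreover have "0 \<le> 3 * u * v / ((real i + 1 + \<alpha>) * (real i + 2 + \<alpha>) * (real i + 3 + \<alpha>))"
    using pos u v by simp
  moreover have "cesaro3_matrix \<alpha> i j =
      3 * u * v / ((real i + 1 + \<alpha>) * (real i + 2 + \<alpha>) * (real i + 3 + \<alpha>))"
    using assms(2) by (simp add: cesaro3_matrix_def u_def v_def)
  ultimately show ?thesis unfolding c_def by linarith
qed

lemma cesaro3_sum_bound:
  assumes "\<alpha> > -1"
  shows "(\<Sum>i<N. (cmod (\<Sum>j\<le>i. complex_of_real (cesaro3_matrix \<alpha> i j) * ell2_nth f j))\<^sup>2)
      \<le> (12 / min 1 (1 + \<alpha>) * norm f)\<^sup>2"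
proof -
  define K where "K = 6 / min 1 (1 + \<alpha>)"
  have K: "0 \<le> K" using assms by (simp add: K_def)
  define a where "a n = cmod (ell2_nth f n)" for n
  have "cmod (\<Sum>j\<le>i. complex_of_real (cesaro3_matrix \<alpha> i j) * ell2_nth f j)
      \<le> K * ((\<Sum>j\<le>i. a j) / (real i + 1))" for i
  proof -
    have "cmod (\<Sum>j\<le>i. complex_of_real (cesaro3_matrix \<alpha> i j) * ell2_nth f j)
        \<le> (\<Sum>j\<le>i. K / (real i + 1) * a j)"
    proof (rule sum_norm_le)
      fix j assume "j \<in> {..i}"
      then have "\<bar>cesaro3_matrix \<alpha> i j\<bar> * a j \<le> K / (real i + 1) * a j"
        unfolding K_def by (intro mult_right_mono cesaro3_matrix_bound assms) (auto simp: a_def)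
      then show "cmod (complex_of_real (cesaro3_matrix \<alpha> i j) * ell2_nth f j) \<le> K / (real i + 1) * a j"
        by (simp add: norm_mult a_def)
    qed
    also have "\<dots> = K * ((\<Sum>j\<le>i. a j) / (real i + 1))"
      by (simp add: sum_distrib_left sum_divide_distrib)
    finally show ?thesis .
  qed
  then have "(\<Sum>i<N. (cmod (\<Sum>j\<le>i. complex_of_real (cesaro3_matrix \<alpha> i j) * ell2_nth f j))\<^sup>2)
      \<le> (\<Sum>i<N. (K * ((\<Sum>j\<le>i. a j) / (real i + 1)))\<^sup>2)"
    by (intro sum_mono power_mono) auto
  also have "\<dots> = K\<^sup>2 * (\<Sum>i<N. ((\<Sum>j\<le>i. a j) / (real i + 1))\<^sup>2)"
    by (simp only: power_mult_distrib sum_distrib_left)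
  also have "\<dots> \<le> K\<^sup>2 * (4 * (\<Sum>i<N. (a i)\<^sup>2))"
    by (intro mult_left_mono hardy_inequality) simp
  also have "\<dots> \<le> K\<^sup>2 * (4 * (norm f)\<^sup>2)"
    using sum_le_norm_ell2[of f N] by (intro mult_left_mono) (auto simp: a_def)
  also have "\<dots> = (2 * K * norm f)\<^sup>2" by (simp add: power_mult_distrib)
  finally show ?thesis by (simp add: K_def)
qed

lemma
  assumes "\<alpha> > -1"
  shows cesaro3_nth: "ell2_nth (cesaro3 \<alpha> f) i =
      (\<Sum>j\<le>i. complex_of_real (cesaro3_matrix \<alpha> i j) * ell2_nth f j)"
    and norm_cesaro3_le: "norm (cesaro3 \<alpha> f) \<le> 12 / min 1 (1 + \<alpha>) * norm f"
proof -
  have K: "0 \<le> 12 / min 1 (1 + \<alpha>) * norm f" using assms by simp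
  note E = ell2_Abs[OF cesaro3_sum_bound[OF assms] K]
  show "ell2_nth (cesaro3 \<alpha> f) i =
      (\<Sum>j\<le>i. complex_of_real (cesaro3_matrix \<alpha> i j) * ell2_nth f j)"
    by (simp add: cesaro3_def matrix_operator_def cesaro3_matrix_suminf E(1))
  show "norm (cesaro3 \<alpha> f) \<le> 12 / min 1 (1 + \<alpha>) * norm f"
    using E(2) by (simp add: cesaro3_def matrix_operator_def cesaro3_matrix_suminf)
qed

lemma bounded_clinear_cesaro3:
  assumes "\<alpha> > -1"
  shows "bounded_clinear (cesaro3 \<alpha>)"
  unfolding bounded_clinear_def
proof (intro conjI allI bounded_linear_intro)
  fix x y :: ell2 and r :: real and c :: complex
  show "cesaro3 \<alpha> (x + y) = cesaro3 \<alpha> x + cesaro3 \<alpha> y"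
    by (rule ell2_eqI) (simp add: cesaro3_nth[OF assms] plus_ell2.rep_eq distrib_left sum.distrib)
  show C: "cesaro3 \<alpha> (c *\<^sub>C x) = c *\<^sub>C cesaro3 \<alpha> x" for c
    by (rule ell2_eqI)
      (simp add: cesaro3_nth[OF assms] scaleC_ell2.rep_eq sum_distrib_left mult.left_commute)
  show "cesaro3 \<alpha> (r *\<^sub>R x) = r *\<^sub>R cesaro3 \<alpha> x"
    using C[of "complex_of_real r"] by (simp add: scaleC_of_real)
  show "norm (cesaro3 \<alpha> x) \<le> norm x * (12 / min 1 (1 + \<alpha>))"
    using norm_cesaro3_le[OF assms, of x] by (simp add: mult.commute)
qed

end

theory Submission imports Defs begin

text \<open>Let \<open>L\<close> be the forward third difference and \<open>D\<close> the diagonal matrix with entries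
  \<open>1 / ((i+1+\<alpha>)(i+2+\<alpha>)(i+3+\<alpha>))\<close>, so that \<open>M = 6 D (I - S)\<^sup>-\<^sup>3\<close> for the unilateral shift
  \<open>S\<close>. The unbounded operator \<open>X = D\<^sup>-\<^sup>1 L / 6\<close> satisfies \<open>X M\<^sup>* = I\<close>. Although \<open>X\<close> is
  unbounded, both \<open>B = X M\<close> and \<open>E = M X\<close> are bounded: their entries are \<open>O(1/(i+1))\<close> on
  and below the diagonal, bounded on three superdiagonals and zero beyond, so that Hardy's
  inequality applies. Now \<open>L M\<^sup>* B = L M\<close> and \<open>L\<close> is injective on null sequences, whence
  \<open>M = M\<^sup>* B\<close>; and \<open>E M\<^sup>* = M X M\<^sup>* = M\<close>. Taking adjoints, \<open>M M\<^sup>* = M\<^sup>* (B B\<^sup>*) M\<close> and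
  \<open>M\<^sup>* M = M (E\<^sup>* E) M\<^sup>*\<close>.\<close>

section \<open>Adjoints and factorizations\<close>

lemma adjoint_sym:
  fixes A B :: "'a::complex_hilbert_space \<Rightarrow> 'a"
  assumes "\<And>x y. cinner (A x) y = cinner x (B y)"
  shows "cinner (B x) y = cinner x (A y)"
  by (metis assms cinner_commute)

text \<open>\<open>C' \<circ> B'\<close> satisfies the relation that characterizes the adjoint of
  \<open>A\<close>, and \<open>cadjoint_eqI\<close> makes such a map unique.\<close>

lemma adjoint_comp:
  fixes A :: "'a::complex_hilbert_space \<Rightarrow> 'a"
  assumes "\<And>x y. cinner (A x) y = cinner x (A' y)" "\<And>x y. cinner (B x) y = cinner x (B' y)"
    and "A = B \<circ> C" "\<And>x y. cinner (C x) y = cinner x (C' y)"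
  shows "A' = C' \<circ> B'"
proof -
  have "cinner (A x) y = cinner x ((C' \<circ> B') y)" for x y
    by (simp add: assms(2-4))
  then show ?thesis
    using cadjoint_eqI[of A A'] cadjoint_eqI[of A "C' \<circ> B'"] assms(1) by simp
qed

lemma bounded_clinear_comp:
  assumes "bounded_clinear A" "bounded_clinear B"
  shows "bounded_clinear (A \<circ> B)"
  using assms by (auto simp: bounded_clinear_def o_def intro: bounded_linear_compose)

text \<open>Moving \<open>A\<close> across the inner product turns \<open>cinner (A (B x)) x\<close>
  into \<open>cinner (B x) (B x)\<close>, which is real and nonnegative.\<close>

lemma positive_operator_adjoint_comp:
  fixes A :: "'a::complex_hilbert_space \<Rightarrow> 'a"
  assumes "bounded_clinear A" "bounded_clinear B"
    and "\<And>x y. cinner (A x) y = cinner x (B y)"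
  shows "positive_operator (A \<circ> B)"
proof -
  have "cinner (B x) (B x) \<in> \<real>\<^sub>\<ge>\<^sub>0" for x
  proof -
    have "Im (cinner (B x) (B x)) = 0"
      using arg_cong[OF cinner_commute[of "B x" "B x"], of Im] by simp
    then show ?thesis by (simp add: complex_nonneg_Reals_iff Re_cinner)
  qed
  then show ?thesis
    using assms by (simp add: positive_operator_def bounded_clinear_comp)
qed

text \<open>Taking adjoints in \<open>A = A' \<circ> B\<close> gives
  \<open>A' = B' \<circ> A\<close>. Multiplying the two factorizations yields
  \<open>A \<circ> A' = A' \<circ> (B \<circ> B') \<circ> A\<close>, so \<open>B \<circ> B'\<close>
  serves as the positive operator.\<close>

lemma posinormal_if_factor:
  fixes A :: "'a::complex_hilbert_space \<Rightarrow> 'a"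
  assumes "bounded_clinear A" "bounded_clinear B" "bounded_clinear B'"
    and adjA: "\<And>x y. cinner (A x) y = cinner x (A' y)"
    and adjB: "\<And>x y. cinner (B x) y = cinner x (B' y)"
    and "A = A' \<circ> B"
  shows "posinormal A"
proof -
  have A': "A' = B' \<circ> A"
    by (rule adjoint_comp[OF adjA adjoint_sym[OF adjA] assms(6) adjB])
  have "positive_operator (B \<circ> B')"
    by (rule positive_operator_adjoint_comp[OF assms(2,3) adjB])
  moreover have "A \<circ> cadjoint A = cadjoint A \<circ> (B \<circ> B') \<circ> A"
    unfolding cadjoint_eqI[OF adjA] by (metis A' assms(6) comp_assoc)
  ultimately show ?thesis
    using assms(1) unfolding posinormal_def by blast
qed

text \<open>The mirror image: \<open>A = B \<circ> A'\<close> gives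
  \<open>A' = A \<circ> B'\<close>, hence
  \<open>A' \<circ> A = A \<circ> (B' \<circ> B) \<circ> A'\<close>.\<close>

lemma coposinormal_if_factor:
  fixes A :: "'a::complex_hilbert_space \<Rightarrow> 'a"
  assumes "bounded_clinear A" "bounded_clinear B" "bounded_clinear B'"
    and adjA: "\<And>x y. cinner (A x) y = cinner x (A' y)"
    and adjB: "\<And>x y. cinner (B x) y = cinner x (B' y)"
    and "A = B \<circ> A'"
  shows "coposinormal A"
proof -
  have A': "A' = A \<circ> B'"
    by (rule adjoint_comp[OF adjA adjB assms(6) adjoint_sym[OF adjA]])
  have "positive_operator (B' \<circ> B)"
    by (rule positive_operator_adjoint_comp[OF assms(3,2) adjoint_sym[OF adjB]])
  moreover have "A \<circ> (B' \<circ> B) \<circ> cadjoint A = cadjoint A \<circ> A"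
    unfolding cadjoint_eqI[OF adjA] by (metis A' assms(6) comp_assoc)
  ultimately show ?thesis
    using assms(1) unfolding coposinormal_def by blast
qed

section \<open>Bounded operators on square-summable sequences\<close>

lift_definition ell2_unit :: "nat \<Rightarrow> ell2" is "\<lambda>k n. if n = k then 1 else 0"
  by (rule summable_finite[of "{k}" for k]) auto

lemma cinner_ell2_unit_right: "cinner x (ell2_unit k) = ell2_nth x k"
  unfolding cinner_ell2_def by (subst suminf_finite[of "{k}"]) (auto simp: ell2_unit.rep_eq)

lemma ell2_nth_sum: "ell2_nth (sum f A) n = (\<Sum>k\<in>A. ell2_nth (f k) n)"
  by (induction A rule: infinite_finite_induct) (simp_all add: zero_ell2.rep_eq plus_ell2.rep_eq)

text \<open>Written as a finite combination of unit vectors, so that linear maps can be applied term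
  by term.\<close>

definition ell2_trunc :: "nat \<Rightarrow> (nat \<Rightarrow> complex) \<Rightarrow> ell2" where
  "ell2_trunc N f = (\<Sum>k<N. f k *\<^sub>C ell2_unit k)"

lemma ell2_nth_trunc: "ell2_nth (ell2_trunc N f) n = (if n < N then f n else 0)"
  by (simp add: ell2_trunc_def ell2_nth_sum scaleC_ell2.rep_eq ell2_unit.rep_eq
      if_distrib[of "\<lambda>z. _ * z"] cong: if_cong)

lemma norm_ell2_trunc: "(norm (ell2_trunc N f))\<^sup>2 = (\<Sum>n<N. (cmod (f n))\<^sup>2)"
  unfolding norm_ell2_square ell2_nth_trunc
  by (subst suminf_finite[of "{..<N}"]) auto

text \<open>The squared distance from \<open>x\<close> to its truncation is the tail of the
  convergent series for \<open>(norm x)\<^sup>2\<close>.\<close>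

lemma ell2_trunc_tendsto: "(\<lambda>N. ell2_trunc N (ell2_nth x)) \<longlonglongrightarrow> x"
proof -
  have "(norm (x - ell2_trunc N (ell2_nth x)))\<^sup>2
      = (norm x)\<^sup>2 - (\<Sum>n<N. (cmod (ell2_nth x n))\<^sup>2)" for N
  proof -
    let ?f = "\<lambda>n. (cmod (ell2_nth x n))\<^sup>2"
    have "(norm (x - ell2_trunc N (ell2_nth x)))\<^sup>2 = (\<Sum>n. ?f n - (if n < N then ?f n else 0))"
      unfolding norm_ell2_square by (intro suminf_cong) (simp add: ell2_nth_diff ell2_nth_trunc)
    also have "\<dots> = (\<Sum>n. ?f n) - (\<Sum>n. if n < N then ?f n else 0)"
      by (rule suminf_diff[symmetric, OF summable_ell2])
        (rule summable_finite[of "{..<N}"], auto)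
    also have "(\<Sum>n. if n < N then ?f n else 0) = (\<Sum>n<N. ?f n)"
      by (subst suminf_finite[of "{..<N}"]) auto
    finally show ?thesis by (simp add: norm_ell2_square)
  qed
  moreover have "(\<lambda>N. (norm x)\<^sup>2 - (\<Sum>n<N. (cmod (ell2_nth x n))\<^sup>2)) \<longlonglongrightarrow> (norm x)\<^sup>2 - (norm x)\<^sup>2"
    unfolding norm_ell2_square[of x] by (intro tendsto_intros summable_LIMSEQ summable_ell2)
  ultimately have "(\<lambda>N. (norm (x - ell2_trunc N (ell2_nth x)))\<^sup>2) \<longlonglongrightarrow> 0" by simp
  from tendsto_real_sqrt[OF this]
  have "(\<lambda>N. norm (ell2_trunc N (ell2_nth x) - x)) \<longlonglongrightarrow> 0"
    by (simp add: norm_minus_commute)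
  then show ?thesis by (rule LIM_zero_cancel[OF tendsto_norm_zero_cancel])
qed

section \<open>Complex Cauchy-Schwarz inequality and existence of adjoints\<close>

lemma norm_scaleC: "norm (c *\<^sub>C x) = cmod c * norm x" for x :: "'a::complex_hilbert_space"
proof (rule power2_eq_imp_eq)
  \<comment> \<open>The class axioms tie the norm only to the real part of \<open>cinner\<close>;
    conjugate symmetry shows that \<open>cinner y y\<close> has no imaginary part.\<close>
  have "complex_of_real ((norm y)\<^sup>2) = cinner y y" for y :: 'a
  proof (rule complex_eqI)
    show "Re (complex_of_real ((norm y)\<^sup>2)) = Re (cinner y y)"
      by (simp add: Re_cinner power2_norm_eq_inner)
    show "Im (complex_of_real ((norm y)\<^sup>2)) = Im (cinner y y)"
      using arg_cong[OF cinner_commute[of y y], of Im] by simp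
  qed
  moreover have "cinner (c *\<^sub>C x) (c *\<^sub>C x) = c * (cnj c * cinner x x)"
    by (metis cinner_scaleC_left cinner_commute complex_cnj_mult)
  ultimately have "complex_of_real ((norm (c *\<^sub>C x))\<^sup>2) = c * cnj c * complex_of_real ((norm x)\<^sup>2)"
    by (simp add: mult.assoc)
  also have "\<dots> = complex_of_real ((cmod c * norm x)\<^sup>2)"
    by (simp only: power_mult_distrib of_real_mult complex_norm_square)
  finally show "(norm (c *\<^sub>C x))\<^sup>2 = (cmod c * norm x)\<^sup>2"
    by (simp only: of_real_eq_iff)
qed simp_all

lemma cmod_cinner_le: "cmod (cinner x y) \<le> norm x * norm y" for x :: "'a::complex_hilbert_space"
proof (cases "cinner x y = 0")
  case False
  \<comment> \<open>A phase of modulus one that rotates \<open>cinner x y\<close> onto the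
    nonnegative real axis, where the real Cauchy-Schwarz inequality applies.\<close>
  define c where "c = cnj (cinner x y) / complex_of_real (cmod (cinner x y))"
  have c: "cmod c = 1" using False by (simp add: c_def norm_divide)
  have "cmod (cinner x y) = Re (c * cinner x y)"
    using False by (simp add: c_def mult.commute complex_norm_square[symmetric] power2_eq_square)
  also have "\<dots> = (c *\<^sub>C x) \<bullet> y" by (simp add: Re_cinner flip: cinner_scaleC_left)
  also have "\<dots> \<le> norm (c *\<^sub>C x) * norm y" by (rule norm_cauchy_schwarz)
  finally show ?thesis by (simp add: norm_scaleC c)
qed simp

lemma cinner_sum_left: "cinner (sum f A) y = (\<Sum>k\<in>A. cinner (f k) y)"
  for y :: "'a::complex_hilbert_space"
proof (induction A rule: infinite_finite_induct)
  have "cinner 0 y = 0" using cinner_add_left[of 0 0 y] by simp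
  then show "cinner (sum f {}) y = (\<Sum>k\<in>{}. cinner (f k) y)"
    and "infinite A \<Longrightarrow> cinner (sum f A) y = (\<Sum>k\<in>A. cinner (f k) y)" for A by simp_all
qed (simp add: cinner_add_left)

lemma tendsto_cinner_left:
  fixes y :: "'a::complex_hilbert_space"
  assumes "(X \<longlongrightarrow> x) F"
  shows "((\<lambda>n. cinner (X n) y) \<longlongrightarrow> cinner x y) F"
proof -
  have "cinner (r *\<^sub>R z) y = r *\<^sub>R cinner z y" for r z
    by (metis cinner_scaleC_left scaleC_of_real scaleR_conv_of_real)
  then have "bounded_linear (\<lambda>z. cinner z y)"
    by (intro bounded_linear_intro[where K = "norm y"]) (auto simp: cinner_add_left cmod_cinner_le)
  then show ?thesis using assms by (rule bounded_linear.tendsto)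
qed

lemma ex_adjoint_ell2:
  fixes A :: "ell2 \<Rightarrow> ell2"
  assumes "bounded_clinear A"
  obtains B where "bounded_clinear B" "\<And>x y. cinner (A x) y = cinner x (B y)"
proof -
  have lin: "bounded_linear A" and C: "\<And>c x. A (c *\<^sub>C x) = c *\<^sub>C A x"
    using assms by (auto simp: bounded_clinear_def)
  obtain K where K: "K \<ge> 0" "\<And>x. norm (A x) \<le> norm x * K"
    using bounded_linear.nonneg_bounded[OF lin] by blast
  \<comment> \<open>The value that coordinate \<open>j\<close> of the adjoint image of
    \<open>y\<close> must have, by testing with \<open>ell2_unit j\<close>.\<close>
  define b where "b y j = cinner y (A (ell2_unit j))" for y j
  have Atr: "cinner (A (ell2_trunc N f)) y = (\<Sum>j<N. f j * cnj (b y j))" for N f y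
    unfolding ell2_trunc_def linear_sum[OF bounded_linear.linear[OF lin]] C
    by (simp add: cinner_sum_left cinner_scaleC_left b_def flip: cinner_commute)
  have bound: "(\<Sum>j<N. (cmod (b y j))\<^sup>2) \<le> (K * norm y)\<^sup>2" for N y
  proof -
    \<comment> \<open>Testing \<open>A\<close> on the truncation of \<open>b y\<close> itself gives
      \<open>(norm v)\<^sup>2 = cinner (A v) y\<close>, at most \<open>K * norm v * norm y\<close>;
      one factor \<open>norm v\<close> then cancels.\<close>
    define v where "v = ell2_trunc N (b y)"
    have v2: "(\<Sum>j<N. (cmod (b y j))\<^sup>2) = (norm v)\<^sup>2" by (simp add: v_def norm_ell2_trunc)
    have "complex_of_real ((norm v)\<^sup>2) = cinner (A v) y"
      unfolding v_def Atr norm_ell2_trunc of_real_sum by (simp only: complex_norm_square)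
    then have "(norm v)\<^sup>2 = cmod (cinner (A v) y)"
      by (metis abs_of_nonneg norm_of_real zero_le_power2)
    also have "\<dots> \<le> norm (A v) * norm y" by (rule cmod_cinner_le)
    also have "\<dots> \<le> norm v * K * norm y" by (intro mult_right_mono K) simp
    finally have "norm v * norm v \<le> norm v * (K * norm y)"
      by (simp add: power2_eq_square mult.assoc)
    then have "norm v \<le> K * norm y"
      using K(1) by (cases "norm v = 0") (auto simp: mult_le_cancel_left)
    then show ?thesis unfolding v2 by (simp add: power_mono)
  qed
  define B where "B y = Abs_ell2 (b y)" for y
  have nK: "0 \<le> K * norm y" for y :: ell2 using K(1) by simp
  have B: "ell2_nth (B y) j = b y j" and nB: "norm (B y) \<le> K * norm y" for y j
    using ell2_Abs[OF bound nK, of y] by (simp_all add: B_def)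
  have Bscale: "B (c *\<^sub>C x) = c *\<^sub>C B x" for c x
    by (rule ell2_eqI) (simp add: B scaleC_ell2.rep_eq b_def cinner_scaleC_left)
  have "bounded_clinear B"
    unfolding bounded_clinear_def
  proof (intro conjI allI bounded_linear_intro[where K = K])
    show "B (x + y) = B x + B y" for x y
      by (rule ell2_eqI) (simp add: B plus_ell2.rep_eq b_def cinner_add_left)
    show "B (r *\<^sub>R x) = r *\<^sub>R B x" for r x
      using Bscale[of "complex_of_real r"] by (simp add: scaleC_of_real)
  qed (use nB Bscale in \<open>auto simp: mult.commute\<close>)
  \<comment> \<open>The identity holds on truncations by linearity and extends to \<open>x\<close>
    by continuity of both sides.\<close>
  moreover have "cinner (A x) y = cinner x (B y)" for x y
  proof (rule LIMSEQ_unique)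
    show "(\<lambda>N. cinner (A (ell2_trunc N (ell2_nth x))) y) \<longlonglongrightarrow> cinner (A x) y"
      by (intro tendsto_cinner_left bounded_linear.tendsto[OF lin] ell2_trunc_tendsto)
    show "(\<lambda>N. cinner (A (ell2_trunc N (ell2_nth x))) y) \<longlonglongrightarrow> cinner x (B y)"
      using summable_LIMSEQ[OF summable_ell2_mult[of x "B y"]]
      by (simp add: Atr B[symmetric] cinner_ell2_def[of x])
  qed
  ultimately show thesis by (rule that)
qed

text \<open>Hardy's inequality controls the part on and below the diagonal, and each of the three
  superdiagonals is dominated by \<open>K\<close> times a shift. This is the common criterion for
  the boundedness of \<open>X M\<close> and \<open>M X\<close>.\<close>

lemma
  fixes b :: "nat \<Rightarrow> nat \<Rightarrow> real"
  assumes lower: "\<And>i j. j \<le> i \<Longrightarrow> \<bar>b i j\<bar> \<le> K / (real i + 1)"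
    and upper: "\<And>i j. i < j \<Longrightarrow> j \<le> i + 3 \<Longrightarrow> \<bar>b i j\<bar> \<le> K"
    and zero: "\<And>i j. i + 3 < j \<Longrightarrow> b i j = 0"
  defines "A \<equiv> matrix_operator (\<lambda>i j. complex_of_real (b i j))"
  shows hardy_band_nth: "ell2_nth (A f) i = (\<Sum>j\<le>i + 3. complex_of_real (b i j) * ell2_nth f j)"
    and bounded_clinear_hardy_band: "bounded_clinear A"
proof -
  have K: "0 \<le> K" using upper[of 0 1] by simp
  have fin: "(\<Sum>j. complex_of_real (b i j) * g j) = (\<Sum>j\<le>i + 3. complex_of_real (b i j) * g j)" for i g
    by (rule suminf_finite) (auto simp: zero)
  have bound: "(\<Sum>i<N. (cmod (\<Sum>j\<le>i + 3. complex_of_real (b i j) * ell2_nth f j))\<^sup>2)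
      \<le> (6 * K * norm f)\<^sup>2" for N f
  proof -
    define a where "a j = cmod (ell2_nth f j)" for j
    define h where "h i = (\<Sum>j\<le>i. a j) / (real i + 1)" for i
    have "(cmod (\<Sum>j\<le>i + 3. complex_of_real (b i j) * ell2_nth f j))\<^sup>2
        \<le> K\<^sup>2 * (4 * ((h i)\<^sup>2 + (a (i + 1))\<^sup>2 + (a (i + 2))\<^sup>2 + (a (i + 3))\<^sup>2))" for i
    proof -
      have "cmod (\<Sum>j\<le>i + 3. complex_of_real (b i j) * ell2_nth f j) \<le> (\<Sum>j\<le>i + 3. \<bar>b i j\<bar> * a j)"
        by (rule sum_norm_le) (simp add: norm_mult a_def)
      also have "\<dots> = (\<Sum>j\<le>i. \<bar>b i j\<bar> * a j) + \<bar>b i (i + 1)\<bar> * a (i + 1)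
          + \<bar>b i (i + 2)\<bar> * a (i + 2) + \<bar>b i (i + 3)\<bar> * a (i + 3)"
        by (simp add: numeral_3_eq_3)
      also have "\<dots> \<le> (\<Sum>j\<le>i. K / (real i + 1) * a j) + K * a (i + 1) + K * a (i + 2) + K * a (i + 3)"
        by (intro add_mono sum_mono mult_right_mono lower upper) (auto simp: a_def)
      also have "\<dots> = K * (h i + a (i + 1) + a (i + 2) + a (i + 3))"
        by (simp add: h_def sum_distrib_left sum_divide_distrib distrib_left)
      finally have "(cmod (\<Sum>j\<le>i + 3. complex_of_real (b i j) * ell2_nth f j))\<^sup>2
          \<le> (K * (h i + a (i + 1) + a (i + 2) + a (i + 3)))\<^sup>2"
        by (rule power_mono) simp
      also have "\<dots> = K\<^sup>2 * (h i + a (i + 1) + a (i + 2) + a (i + 3))\<^sup>2"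
        by (rule power_mult_distrib)
      \<comment> \<open>The right side minus the left side is the sum of the squares of the six
        pairwise differences.\<close>
      also have "(w + x + y + z)\<^sup>2 \<le> 4 * (w\<^sup>2 + x\<^sup>2 + y\<^sup>2 + z\<^sup>2)" for w x y z :: real
        using zero_le_power2[of "w - x"] zero_le_power2[of "w - y"] zero_le_power2[of "w - z"]
          zero_le_power2[of "x - y"] zero_le_power2[of "x - z"] zero_le_power2[of "y - z"]
        by (simp add: power2_eq_square algebra_simps)
      then have "K\<^sup>2 * (h i + a (i + 1) + a (i + 2) + a (i + 3))\<^sup>2
          \<le> K\<^sup>2 * (4 * ((h i)\<^sup>2 + (a (i + 1))\<^sup>2 + (a (i + 2))\<^sup>2 + (a (i + 3))\<^sup>2))"
        by (intro mult_left_mono) auto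
      finally show ?thesis .
    qed
    then have "(\<Sum>i<N. (cmod (\<Sum>j\<le>i + 3. complex_of_real (b i j) * ell2_nth f j))\<^sup>2)
        \<le> (\<Sum>i<N. K\<^sup>2 * (4 * ((h i)\<^sup>2 + (a (i + 1))\<^sup>2 + (a (i + 2))\<^sup>2 + (a (i + 3))\<^sup>2)))"
      by (rule sum_mono)
    also have "\<dots> = K\<^sup>2 * (4 * ((\<Sum>i<N. (h i)\<^sup>2) + (\<Sum>i<N. (a (i + 1))\<^sup>2)
        + (\<Sum>i<N. (a (i + 2))\<^sup>2) + (\<Sum>i<N. (a (i + 3))\<^sup>2)))"
      by (simp only: sum.distrib flip: sum_distrib_left)
    also have "\<dots> \<le> K\<^sup>2 * (4 * (4 * (norm f)\<^sup>2 + (norm f)\<^sup>2 + (norm f)\<^sup>2 + (norm f)\<^sup>2))"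
    proof -
      have shift: "(\<Sum>i<N. (a (i + r))\<^sup>2) \<le> (norm f)\<^sup>2" for r
      proof -
        have "(\<Sum>i<N. (a (i + r))\<^sup>2) = (\<Sum>i\<in>(\<lambda>i. i + r) ` {..<N}. (a i)\<^sup>2)"
          by (simp add: sum.reindex)
        also have "\<dots> \<le> (\<Sum>i<N + r. (a i)\<^sup>2)" by (rule sum_mono2) auto
        also have "\<dots> \<le> (norm f)\<^sup>2" unfolding a_def by (rule sum_le_norm_ell2)
        finally show ?thesis .
      qed
      have "(\<Sum>i<N. (h i)\<^sup>2) \<le> 4 * (norm f)\<^sup>2"
        using hardy_inequality[of a N] shift[of 0] unfolding h_def by simp
      then show ?thesis by (intro mult_left_mono add_mono shift) auto
    qed
    \<comment> \<open>Hardy contributes 4 and the three shifts 1 each, so the total factor is 4 * 7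
      = 28, at most 36.\<close>
    also have "\<dots> \<le> (6 * K * norm f)\<^sup>2" by (simp add: power_mult_distrib)
    finally show ?thesis .
  qed
  have nK: "0 \<le> 6 * K * norm f" for f :: ell2 using K by simp
  have nth: "ell2_nth (A f) i = (\<Sum>j\<le>i + 3. complex_of_real (b i j) * ell2_nth f j)"
    and nA: "norm (A f) \<le> 6 * K * norm f" for f i
    using ell2_Abs[OF bound nK, of f] by (simp_all add: A_def matrix_operator_def fin)
  show "ell2_nth (A f) i = (\<Sum>j\<le>i + 3. complex_of_real (b i j) * ell2_nth f j)"
    by (rule nth)
  have scale: "A (c *\<^sub>C x) = c *\<^sub>C A x" for c x
    by (rule ell2_eqI) (simp only: nth scaleC_ell2.rep_eq sum_distrib_left mult.left_commute)
  show "bounded_clinear A"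
    unfolding bounded_clinear_def
  proof (intro conjI allI bounded_linear_intro[where K = "6 * K"])
    show "A (x + y) = A x + A y" for x y
      by (rule ell2_eqI) (simp only: nth plus_ell2.rep_eq distrib_left sum.distrib)
    show "A (r *\<^sub>R x) = r *\<^sub>R A x" for r x
      using scale[of "complex_of_real r"] by (simp add: scaleC_of_real)
  qed (use nA scale in \<open>auto simp: mult.commute\<close>)
qed

section \<open>Third differences and the matrix of order three\<close>

text \<open>The map sending \<open>f i\<close> to \<open>f i - f (i + 1)\<close>, applied three
  times. The ring is left general because both real matrix entries and complex sequences are
  differenced.\<close>

definition third_diff :: "(nat \<Rightarrow> 'a::comm_ring_1) \<Rightarrow> nat \<Rightarrow> 'a" where
  "third_diff f i = f i - 3 * f (i + 1) + 3 * f (i + 2) - f (i + 3)"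

lemma eq_0_if_diff_eq_0:
  fixes g :: "nat \<Rightarrow> 'a::real_normed_vector"
  assumes "g \<longlonglongrightarrow> 0" "\<And>i. g i - g (Suc i) = 0"
  shows "g i = 0"
proof -
  have "g n = g 0" for n by (induction n) (use assms(2) in auto)
  then have "g = (\<lambda>_. g 0)" by blast
  then show ?thesis using assms(1) by (metis LIMSEQ_const_iff)
qed

text \<open>First differences of null sequences are null, so the three difference factors can be
  peeled off one at a time. Without convergence to 0, quadratic polynomials would be
  counterexamples.\<close>

lemma eq_0_if_third_diff_eq_0:
  fixes f :: "nat \<Rightarrow> complex"
  assumes f: "f \<longlonglongrightarrow> 0" and 0: "\<And>i. third_diff f i = 0"
  shows "f i = 0"
proof -
  define g where "g i = f i - f (Suc i)" for i
  define h where "h i = g i - g (Suc i)" for i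
  have g0: "g \<longlonglongrightarrow> 0"
    unfolding g_def using tendsto_diff[OF f LIMSEQ_Suc[OF f]] by simp
  have h0: "h \<longlonglongrightarrow> 0"
    unfolding h_def using tendsto_diff[OF g0 LIMSEQ_Suc[OF g0]] by simp
  have "h i - h (Suc i) = 0" for i
    using 0[of i] by (simp add: h_def g_def third_diff_def numeral_3_eq_3 algebra_simps)
  then have "h i = 0" for i by (rule eq_0_if_diff_eq_0[OF h0])
  then have "g i = 0" for i unfolding h_def by (rule eq_0_if_diff_eq_0[OF g0])
  then show ?thesis unfolding g_def by (rule eq_0_if_diff_eq_0[OF f])
qed

lemma ell2_nth_tendsto_0: "ell2_nth x \<longlonglongrightarrow> 0"
proof -
  have "(\<lambda>n. sqrt ((cmod (ell2_nth x n))\<^sup>2)) \<longlonglongrightarrow> sqrt 0"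
    by (intro tendsto_real_sqrt summable_LIMSEQ_zero summable_ell2)
  then show ?thesis by (simp add: tendsto_norm_zero_iff)
qed

text \<open>Lets an identity involving \<open>M'\<close> be checked after differencing, where
  \<open>M'\<close> becomes multiplication by a diagonal.\<close>

lemma ell2_eqI_third_diff:
  assumes "\<And>i. third_diff (ell2_nth x) i = third_diff (ell2_nth y) i"
  shows "x = y"
proof (rule ell2_eqI)
  fix n
  have "ell2_nth (x - y) n = 0"
  proof (rule eq_0_if_third_diff_eq_0[OF ell2_nth_tendsto_0])
    show "third_diff (ell2_nth (x - y)) i = 0" for i
      using assms[of i] by (simp add: third_diff_def ell2_nth_diff algebra_simps)
  qed
  then show "ell2_nth x n = ell2_nth y n" by (simp add: ell2_nth_diff)
qed

section \<open>Weights and differences of the matrix entries\<close>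

definition cesaro3_weight :: "real \<Rightarrow> nat \<Rightarrow> real" where
  "cesaro3_weight \<alpha> i = (real i + 1 + \<alpha>) * (real i + 2 + \<alpha>) * (real i + 3 + \<alpha>)"

lemma cesaro3_weight_pos: "\<alpha> > -1 \<Longrightarrow> cesaro3_weight \<alpha> i > 0"
  by (simp add: cesaro3_weight_def)

lemma cesaro3_weight_mono: "\<alpha> > -1 \<Longrightarrow> i \<le> k \<Longrightarrow> cesaro3_weight \<alpha> i \<le> cesaro3_weight \<alpha> k"
  unfolding cesaro3_weight_def by (intro mult_mono) auto

lemma cesaro3_matrix_eq_0: "i < j \<Longrightarrow> cesaro3_matrix \<alpha> i j = 0"
  by (simp add: cesaro3_matrix_def)

lemma cesaro3_matrix_eq:
  "j \<le> i \<Longrightarrow> cesaro3_matrix \<alpha> i j = 3 * (real i + 1 - real j) * (real i + 2 - real j) / cesaro3_weight \<alpha> i"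
  by (simp add: cesaro3_matrix_def cesaro3_weight_def)

text \<open>Close to the diagonal the numerator is at most 3 * 3 * 4 = 36, and by monotonicity the
  ratio of the weights is at most 1.\<close>

lemma cesaro3_weight_mult_matrix_le:
  assumes "\<alpha> > -1" "l \<le> i" "i \<le> k + 2"
  shows "\<bar>cesaro3_weight \<alpha> l * cesaro3_matrix \<alpha> i k\<bar> \<le> 36"
proof (cases "k \<le> i")
  case True
  note pos = cesaro3_weight_pos[OF assms(1)]
  define q where "q = (real i + 1 - real k) * (real i + 2 - real k)"
  have "q \<le> 3 * 4"
    unfolding q_def using assms(3) True by (intro mult_mono) auto
  then have q: "0 \<le> q" "q \<le> 12" using True by (auto simp: q_def)
  have "cesaro3_weight \<alpha> l * (3 * q) \<le> cesaro3_weight \<alpha> i * 36"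
    using q pos[of i] pos[of l] cesaro3_weight_mono[OF assms(1,2)] by (intro mult_mono) auto
  then have "\<bar>cesaro3_weight \<alpha> l * (3 * q / cesaro3_weight \<alpha> i)\<bar> \<le> 36"
    using pos[of i] pos[of l] q by (simp add: abs_mult pos_divide_le_eq mult.commute)
  moreover have "cesaro3_matrix \<alpha> i k = 3 * q / cesaro3_weight \<alpha> i"
    unfolding cesaro3_matrix_eq[OF True] q_def by (simp only: mult.assoc)
  ultimately show ?thesis by simp
qed (simp add: cesaro3_matrix_eq_0)

text \<open>Row \<open>n\<close> is a quadratic polynomial in the column index which also vanishes
  at columns \<open>n + 1\<close> and \<open>n + 2\<close>. Its extension by zero first departs from
  the polynomial at column \<open>n + 3\<close>, where the polynomial equals
  \<open>6 / cesaro3_weight \<alpha> n\<close>; only \<open>k = n\<close> sees this.\<close>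

lemma third_diff_cesaro3_matrix:
  assumes "\<alpha> > -1"
  shows "third_diff (cesaro3_matrix \<alpha> n) k = (if n = k then 6 / cesaro3_weight \<alpha> n else 0)"
proof -
  consider "n < k" | "n = k" | "n = k + 1" | "n = k + 2" | "k + 3 \<le> n" by linarith
  then show ?thesis
  proof cases
    case 5
    then show ?thesis
      using cesaro3_weight_pos[OF assms, of n]
      by (simp add: third_diff_def cesaro3_matrix_eq field_simps)
  qed (simp_all add: third_diff_def cesaro3_matrix_eq cesaro3_matrix_eq_0 field_simps)
qed

text \<open>This is \<open>X M\<^sup>* = I\<close> in coordinates. The difference is taken inside
  the series for \<open>M' y\<close>, and the preceding lemma leaves a single term.\<close>

lemma third_diff_adjoint_cesaro3:
  assumes \<alpha>: "\<alpha> > -1" and adj: "\<And>x y. cinner (cesaro3 \<alpha> x) y = cinner x (M' y)"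
  shows "third_diff (ell2_nth (M' y)) k = complex_of_real (6 / cesaro3_weight \<alpha> k) * ell2_nth y k"
proof -
  let ?m = "cesaro3_matrix \<alpha>"
  \<comment> \<open>Row \<open>j\<close> of the adjoint is column \<open>j\<close> of the matrix;
    the entries are real, so conjugation leaves them unchanged.\<close>
  have s: "(\<lambda>n. ell2_nth y n * complex_of_real (?m n j)) sums ell2_nth (M' y) j" for j
  proof -
    have nth: "ell2_nth (cesaro3 \<alpha> (ell2_unit j)) n = complex_of_real (?m n j)" for n
      unfolding cesaro3_nth[OF \<alpha>] ell2_unit.rep_eq
      by (cases "j \<le> n") (auto simp: cesaro3_matrix_eq_0 if_distrib[of "\<lambda>z. _ * z"] cong: if_cong)
    have "ell2_nth (M' y) j = cinner y (cesaro3 \<alpha> (ell2_unit j))"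
      by (simp flip: cinner_ell2_unit_right adjoint_sym[OF adj])
    then show ?thesis
      using summable_sums[OF summable_ell2_mult[of y "cesaro3 \<alpha> (ell2_unit j)"]]
      by (simp add: nth cinner_ell2_def)
  qed
  have "(\<lambda>n. ell2_nth y n * complex_of_real (?m n k) - 3 * (ell2_nth y n * complex_of_real (?m n (k + 1)))
      + 3 * (ell2_nth y n * complex_of_real (?m n (k + 2))) - ell2_nth y n * complex_of_real (?m n (k + 3)))
      sums third_diff (ell2_nth (M' y)) k"
    unfolding third_diff_def by (intro sums_add sums_diff sums_mult s)
  moreover have "ell2_nth y n * complex_of_real (?m n k) - 3 * (ell2_nth y n * complex_of_real (?m n (k + 1)))
      + 3 * (ell2_nth y n * complex_of_real (?m n (k + 2))) - ell2_nth y n * complex_of_real (?m n (k + 3))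
      = ell2_nth y n * complex_of_real (third_diff (?m n) k)" for n
    by (simp add: third_diff_def algebra_simps)
  ultimately have "(\<lambda>n. ell2_nth y n * complex_of_real (third_diff (?m n) k)) sums third_diff (ell2_nth (M' y)) k"
    by simp
  moreover have "(\<lambda>n. ell2_nth y n * complex_of_real (third_diff (?m n) k))
      = (\<lambda>n. if n = k then complex_of_real (6 / cesaro3_weight \<alpha> k) * ell2_nth y k else 0)"
    unfolding third_diff_cesaro3_matrix[OF \<alpha>] by auto
  ultimately have "(\<lambda>n. if n = k then complex_of_real (6 / cesaro3_weight \<alpha> k) * ell2_nth y k else 0)
      sums third_diff (ell2_nth (M' y)) k"
    by simp
  then show ?thesis by (rule sums_unique2) (rule sums_single)
qed

text \<open>The matrix of \<open>B = X M\<close>.\<close>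

definition cesaro3_left :: "real \<Rightarrow> nat \<Rightarrow> nat \<Rightarrow> real" where
  "cesaro3_left \<alpha> i j = cesaro3_weight \<alpha> i / 6 * third_diff (\<lambda>k. cesaro3_matrix \<alpha> k j) i"

lemma cesaro3_left_sum:
  assumes "\<alpha> > -1"
  shows "(\<Sum>j\<le>i + 3. complex_of_real (cesaro3_left \<alpha> i j) * ell2_nth f j)
    = complex_of_real (cesaro3_weight \<alpha> i / 6) * third_diff (ell2_nth (cesaro3 \<alpha> f)) i"
proof -
  \<comment> \<open>Rows \<open>i\<close> to \<open>i + 3\<close> are padded with zeros to one
    summation range, so that the difference passes under the sum.\<close>
  have nth: "ell2_nth (cesaro3 \<alpha> f) k = (\<Sum>j\<le>i + 3. complex_of_real (cesaro3_matrix \<alpha> k j) * ell2_nth f j)"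
    if "k \<le> i + 3" for k
    unfolding cesaro3_nth[OF assms]
    by (rule sum.mono_neutral_left) (use that in \<open>auto simp: cesaro3_matrix_eq_0\<close>)
  have "third_diff (ell2_nth (cesaro3 \<alpha> f)) i
      = (\<Sum>j\<le>i + 3. complex_of_real (third_diff (\<lambda>k. cesaro3_matrix \<alpha> k j) i) * ell2_nth f j)"
    by (simp add: third_diff_def nth sum_distrib_left left_diff_distrib distrib_right mult.assoc
        sum.distrib sum_subtractf del: sum.atMost_Suc)
  then show ?thesis
    by (simp add: cesaro3_left_def sum_distrib_left mult.assoc del: sum.atMost_Suc)
qed

text \<open>The matrix of \<open>E = M X\<close>. Moving the differences from the argument of \<open>X\<close> to the weights
  \<open>h\<close> leaves no boundary terms provided that weights of negative index count as zero.\<close>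

definition cesaro3_right :: "real \<Rightarrow> nat \<Rightarrow> nat \<Rightarrow> real" where
  "cesaro3_right \<alpha> i j =
    (let h = (\<lambda>r. if r \<le> j then cesaro3_weight \<alpha> (j - r) * cesaro3_matrix \<alpha> i (j - r) else 0)
     in third_diff h 0 / 6)"

text \<open>Substitute \<open>j = k + r\<close>. The guard is essential because natural subtraction
  truncates: without it \<open>h 0\<close> would be counted again for \<open>j < r\<close>. The
  slack \<open>r \<le> s\<close> lets several shifts share one range.\<close>

lemma sum_shift_zero:
  fixes h f :: "nat \<Rightarrow> 'a::comm_ring_1"
  assumes "\<And>k. i < k \<Longrightarrow> h k = 0" "r \<le> s"
  shows "(\<Sum>j\<le>i + s. (if r \<le> j then h (j - r) else 0) * f j) = (\<Sum>k\<le>i. h k * f (k + r))"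
proof -
  have "(\<Sum>k\<le>i. h k * f (k + r)) = (\<Sum>j\<in>(\<lambda>k. k + r) ` {..i}. h (j - r) * f j)"
    by (simp add: sum.reindex)
  also have "\<dots> = (\<Sum>j\<in>(\<lambda>k. k + r) ` {..i}. (if r \<le> j then h (j - r) else 0) * f j)"
    by (intro sum.cong) auto
  also have "\<dots> = (\<Sum>j\<le>i + s. (if r \<le> j then h (j - r) else 0) * f j)"
  proof (rule sum.mono_neutral_left)
    show "\<forall>j\<in>{..i + s} - (\<lambda>k. k + r) ` {..i}. (if r \<le> j then h (j - r) else 0) * f j = 0"
    proof
      fix j assume j: "j \<in> {..i + s} - (\<lambda>k. k + r) ` {..i}"
      have "i < j - r" if "r \<le> j"
      proof (rule ccontr)
        assume "\<not> i < j - r"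
        then have "j = (j - r) + r" "j - r \<in> {..i}" using that by auto
        then show False using j by blast
      qed
      then show "(if r \<le> j then h (j - r) else 0) * f j = 0" by (simp add: assms(1))
    qed
  qed (use assms(2) in auto)
  finally show ?thesis by simp
qed

text \<open>Summation by parts. Each of the four shifts \<open>r\<close> is handled by
  \<open>sum_shift_zero\<close>, the upper end being free of boundary terms since row
  \<open>i\<close> vanishes beyond column \<open>i\<close>.\<close>

lemma cesaro3_right_sum:
  "(\<Sum>j\<le>i + 3. complex_of_real (cesaro3_right \<alpha> i j) * f j)
    = (\<Sum>k\<le>i. complex_of_real (cesaro3_weight \<alpha> k * cesaro3_matrix \<alpha> i k / 6) * third_diff f k)"
proof -
  define h where "h k = complex_of_real (cesaro3_weight \<alpha> k * cesaro3_matrix \<alpha> i k / 6)" for k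
  have shift: "(\<Sum>j\<le>i + 3. (if r \<le> j then h (j - r) else 0) * f j) = (\<Sum>k\<le>i. h k * f (k + r))"
    if "r \<le> 3" for r
    by (rule sum_shift_zero[OF _ that]) (simp add: h_def cesaro3_matrix_eq_0)
  define H where "H r j = (if r \<le> j then h (j - r) else 0) * f j" for r j
  have "(\<Sum>j\<le>i + 3. complex_of_real (cesaro3_right \<alpha> i j) * f j)
     = (\<Sum>j\<le>i + 3. H 0 j - 3 * H 1 j + 3 * H 2 j - H 3 j)"
    by (intro sum.cong) (auto simp: cesaro3_right_def Let_def third_diff_def h_def H_def numeral_2_eq_2 field_simps)
  also have "\<dots> = (\<Sum>j\<le>i + 3. H 0 j) - 3 * (\<Sum>j\<le>i + 3. H 1 j)
      + 3 * (\<Sum>j\<le>i + 3. H 2 j) - (\<Sum>j\<le>i + 3. H 3 j)"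
    by (simp only: sum.distrib sum_subtractf sum_distrib_left)
  also have "\<dots> = (\<Sum>k\<le>i. h k * f (k + 0)) - 3 * (\<Sum>k\<le>i. h k * f (k + 1))
      + 3 * (\<Sum>k\<le>i. h k * f (k + 2)) - (\<Sum>k\<le>i. h k * f (k + 3))"
    unfolding H_def by (subst (1 2 3 4) shift) auto
  also have "\<dots> = (\<Sum>k\<le>i. h k * third_diff f k)"
    by (simp add: third_diff_def right_diff_distrib distrib_left sum.distrib sum_subtractf
        sum_distrib_left mult.left_commute)
  finally show ?thesis by (simp add: h_def)
qed

text \<open>The coefficients have absolute values 1, 3, 3, 1, with sum 8.\<close>

lemma abs_third_diff_le:
  fixes f :: "nat \<Rightarrow> real"
  assumes "\<bar>f i\<bar> \<le> K" "\<bar>f (i + 1)\<bar> \<le> K" "\<bar>f (i + 2)\<bar> \<le> K" "\<bar>f (i + 3)\<bar> \<le> K"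
  shows "\<bar>third_diff f i\<bar> \<le> 8 * K"
  using assms unfolding third_diff_def by linarith

lemma abs_mult_le:
  fixes x y :: "'a::linordered_idom"
  assumes "\<bar>x\<bar> \<le> X" "\<bar>y\<bar> \<le> Y"
  shows "\<bar>x * y\<bar> \<le> X * Y"
  unfolding abs_mult using assms by (intro mult_mono) auto

section \<open>Bounds on the entries\<close>

text \<open>Only rows up to \<open>i + 3 \<le> j + 2\<close> enter, so every term is near the
  diagonal, and 8 * 36 / 6 = 48.\<close>

lemma cesaro3_left_upper:
  assumes "\<alpha> > -1" "i < j"
  shows "\<bar>cesaro3_left \<alpha> i j\<bar> \<le> 48"
proof -
  have "\<bar>cesaro3_weight \<alpha> i * cesaro3_matrix \<alpha> k j\<bar> \<le> 36" if "i \<le> k" "k \<le> i + 3" for k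
    by (rule cesaro3_weight_mult_matrix_le) (use assms that in auto)
  then have "\<bar>third_diff (\<lambda>k. cesaro3_weight \<alpha> i * cesaro3_matrix \<alpha> k j) i\<bar> \<le> 8 * 36"
    by (intro abs_third_diff_le) auto
  then show ?thesis by (simp add: cesaro3_left_def third_diff_def algebra_simps)
qed

text \<open>With \<open>a = i + 1 + \<alpha>\<close> and \<open>u = j + \<alpha>\<close>,
  \<open>f\<close> is column \<open>j\<close> of the matrix as a function of the row. Single
  weighted terms can grow quadratically; the cancellation leaves a quadratic over a cubic.\<close>

lemma third_diff_column:
  fixes a u :: real
  assumes "a > 0"
  defines "f \<equiv> \<lambda>a. 3 * (a - u) * (a + 1 - u) / (a * (a + 1) * (a + 2))"
  shows "a * (a + 1) * (a + 2) / 6 * (f a - 3 * f (a + 1) + 3 * f (a + 2) - f (a + 3))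
    = 3 * (a * a + a - 8 * (u * a) + 10 * (u * u) - 10 * u) / ((a + 3) * (a + 4) * (a + 5))"
proof -
  have 1: "a \<noteq> 0" "a + 1 \<noteq> 0" "a + 2 \<noteq> 0" "a + 3 \<noteq> 0" "a + 4 \<noteq> 0" "a + 5 \<noteq> 0"
    using assms(1) by auto
  have 2: "a + 1 + 1 = a + 2" "a + 1 + 2 = a + 3" "a + 2 + 1 = a + 3" "a + 2 + 2 = a + 4"
    "a + 3 + 1 = a + 4" "a + 3 + 2 = a + 5" by auto
  show ?thesis
    unfolding f_def 2 using 1 by (simp add: divide_simps) algebra
qed

lemma cesaro3_left_lower:
  assumes \<alpha>: "\<alpha> > -1" and ji: "j \<le> i"
  shows "\<bar>cesaro3_left \<alpha> i j\<bar> \<le> 90 * (1 + \<bar>\<alpha>\<bar>)\<^sup>2 / (real i + 1)"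
proof -
  define n b a u where "n = real i + 1" and "b = (1 + \<bar>\<alpha>\<bar>) * n"
    and "a = real i + 1 + \<alpha>" and "u = real j + \<alpha>"
  have "\<bar>\<alpha>\<bar> * 1 \<le> \<bar>\<alpha>\<bar> * n" unfolding n_def by (rule mult_left_mono) auto
  then have n: "n \<ge> 1" and b: "1 \<le> b" "\<bar>a\<bar> \<le> b" "\<bar>u\<bar> \<le> b" and a: "a > 0"
    using \<alpha> ji by (auto simp: n_def b_def a_def u_def distrib_right)
  have bb: "1 \<le> b * b" "b \<le> b * b" using b(1) mult_mono[of 1 b 1 b] mult_mono[of 1 b b b] by auto
  have D: "n * n * n \<le> (a + 3) * (a + 4) * (a + 5)"
    using n \<alpha> by (intro mult_mono) (auto simp: n_def a_def)
  have eq: "cesaro3_left \<alpha> i j = 3 * (a * a + a - 8 * (u * a) + 10 * (u * u) - 10 * u) / ((a + 3) * (a + 4) * (a + 5))"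
    using ji unfolding third_diff_column[OF a, symmetric] cesaro3_left_def third_diff_def
    by (simp add: cesaro3_matrix_eq cesaro3_weight_def a_def u_def algebra_simps)
  \<comment> \<open>All five monomials are at most \<open>b * b\<close> in absolute value, and 3 *
    (1 + 1 + 8 + 10 + 10) = 90.\<close>
  have "\<bar>3 * (a * a + a - 8 * (u * a) + 10 * (u * u) - 10 * u)\<bar> \<le> 90 * (b * b)"
  proof -
    have "\<bar>3 * (x + a - 8 * y + 10 * z - 10 * u)\<bar> \<le> 90 * t"
      if "\<bar>x\<bar> \<le> t" "\<bar>y\<bar> \<le> t" "\<bar>z\<bar> \<le> t" "\<bar>a\<bar> \<le> t" "\<bar>u\<bar> \<le> t" for x y z t :: real
      using that by (auto simp: abs_le_iff)
    from this[OF abs_mult_le[OF b(2,2)] abs_mult_le[OF b(3,2)] abs_mult_le[OF b(3,3)]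
            order_trans[OF b(2) bb(2)] order_trans[OF b(3) bb(2)]]
    show ?thesis .
  qed
  then have "\<bar>cesaro3_left \<alpha> i j\<bar> \<le> 90 * (b * b) / (n * n * n)"
    unfolding eq abs_divide using n D by (intro frac_le) auto
  also have "\<dots> = 90 * (1 + \<bar>\<alpha>\<bar>)\<^sup>2 / n"
    using n by (simp add: b_def power2_eq_square field_simps)
  finally show ?thesis by (simp add: n_def)
qed

lemma cesaro3_left_eq_0: "i + 3 < j \<Longrightarrow> cesaro3_left \<alpha> i j = 0"
  by (simp add: cesaro3_left_def third_diff_def cesaro3_matrix_eq_0)

lemma cesaro3_right_upper:
  assumes "\<alpha> > -1" "i < j"
  shows "\<bar>cesaro3_right \<alpha> i j\<bar> \<le> 48"
proof -
  have h: "\<bar>cesaro3_weight \<alpha> (j - r) * cesaro3_matrix \<alpha> i (j - r)\<bar> \<le> 36" if "r \<le> 3" for r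
  proof (cases "j - r \<le> i")
    case True
    then show ?thesis by (intro cesaro3_weight_mult_matrix_le) (use assms that in auto)
  qed (simp add: cesaro3_matrix_eq_0)
  have "\<bar>third_diff (\<lambda>r. if r \<le> j then cesaro3_weight \<alpha> (j - r) * cesaro3_matrix \<alpha> i (j - r) else 0) 0\<bar>
      \<le> 8 * 36"
    using h[of 0] h[of 1] h[of 2] h[of 3] by (intro abs_third_diff_le) (auto simp: numeral_2_eq_2)
  then show ?thesis by (simp add: cesaro3_right_def)
qed

lemma cesaro3_right_boundary:
  assumes \<alpha>: "\<alpha> > -1" and "j \<le> 2" "j \<le> i"
  shows "\<bar>cesaro3_right \<alpha> i j\<bar> \<le> 8 * cesaro3_weight \<alpha> 2 / min 1 (1 + \<alpha>) / (real i + 1)"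
proof -
  define K where "K = cesaro3_weight \<alpha> 2 * (6 / min 1 (1 + \<alpha>) / (real i + 1))"
  have h: "\<bar>cesaro3_weight \<alpha> (j - r) * cesaro3_matrix \<alpha> i (j - r)\<bar> \<le> K" for r
  proof -
    have "\<bar>cesaro3_weight \<alpha> (j - r)\<bar> \<le> cesaro3_weight \<alpha> 2"
      using cesaro3_weight_pos[OF \<alpha>, of "j - r"] cesaro3_weight_mono[OF \<alpha>, of "j - r" 2] assms(2) by simp
    then show ?thesis
      unfolding K_def by (intro abs_mult_le cesaro3_matrix_bound) (use assms in auto)
  qed
  then have "0 \<le> K" using abs_ge_zero order_trans by blast
  then have "\<bar>third_diff (\<lambda>r. if r \<le> j then cesaro3_weight \<alpha> (j - r) * cesaro3_matrix \<alpha> i (j - r) else 0) 0\<bar>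
      \<le> 8 * K"
    using h[of 0] h[of 1] h[of 2] h[of 3] by (intro abs_third_diff_le) (auto simp: numeral_2_eq_2)
  then show ?thesis by (simp add: cesaro3_right_def K_def)
qed

text \<open>With \<open>a = j + 1 + \<alpha>\<close> and \<open>w = i + 2 + \<alpha>\<close>,
  \<open>h\<close> is weight times row entry up to the factor
  \<open>1 / cesaro3_weight \<alpha> i\<close>. The third difference lowers the total degree from 5
  to 2.\<close>

lemma third_diff_row:
  fixes a w :: real
  defines "h \<equiv> \<lambda>a. a * (a + 1) * (a + 2) * (3 * (w - a) * (w - a + 1))"
  shows "(h a - 3 * h (a - 1) + 3 * h (a - 2) - h (a - 3)) / 6
    = 30 * (a * (a + 1)) - 24 * (w * a) - 96 * a + 3 * (w * w) + 21 * w + 36"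
  unfolding h_def by (simp add: field_simps)

lemma cesaro3_right_interior:
  assumes \<alpha>: "\<alpha> > -1" and j: "3 \<le> j" "j \<le> i"
  shows "\<bar>cesaro3_right \<alpha> i j\<bar> \<le> 300 * (1 + \<bar>\<alpha>\<bar>)\<^sup>2 / min 1 (1 + \<alpha>) / (real i + 1)"
proof -
  define c where "c = min 1 (1 + \<alpha>)"
  have c: "0 < c" "c \<le> 1" "c \<le> 1 + \<alpha>" using assms by (auto simp: c_def)
  define n b a w where "n = real i + 1" and "b = (1 + \<bar>\<alpha>\<bar>) * n"
    and "a = real j + 1 + \<alpha>" and "w = real i + 2 + \<alpha>"
  have "\<bar>\<alpha>\<bar> * 1 \<le> \<bar>\<alpha>\<bar> * n" unfolding n_def by (rule mult_left_mono) auto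
  then have n: "n \<ge> 1" and b: "1 \<le> b" "\<bar>a\<bar> \<le> b" "\<bar>w\<bar> \<le> 2 * b"
    using \<alpha> j by (auto simp: n_def b_def a_def w_def distrib_right)
  have bb: "1 \<le> b * b" "b \<le> b * b" using b(1) mult_mono[of 1 b 1 b] mult_mono[of 1 b b b] by auto
  have "c * real i \<le> real i" using c by (simp add: mult_left_le_one_le)
  then have "c * n \<le> real i + 1 + \<alpha>" using c by (simp add: n_def algebra_simps)
  \<comment> \<open>For negative \<open>\<alpha>\<close> the first factor of the weight drops below
    \<open>n\<close>; the constant \<open>c\<close> compensates for this.\<close>
  then have D: "c * n * n * n \<le> cesaro3_weight \<alpha> i"
    unfolding cesaro3_weight_def using n \<alpha> c by (intro mult_mono) (auto simp: n_def)
  define h where "h a = a * (a + 1) * (a + 2) * (3 * (w - a) * (w - a + 1))" for a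
  \<comment> \<open>Since \<open>3 \<le> j\<close>, no subtraction truncates and the guards all
    hold.\<close>
  have "cesaro3_weight \<alpha> (j - r) * cesaro3_matrix \<alpha> i (j - r) = h (a - real r) / cesaro3_weight \<alpha> i"
    if "r \<le> 3" for r
  proof -
    have "real (j - r) + 1 + \<alpha> = a - real r" "real (j - r) + 2 + \<alpha> = a - real r + 1"
      "real (j - r) + 3 + \<alpha> = a - real r + 2" "real i + 1 - real (j - r) = w - (a - real r)"
      "real i + 2 - real (j - r) = w - (a - real r) + 1" "j - r \<le> i"
      using j that by (auto simp: of_nat_diff a_def w_def)
    then show ?thesis
      by (simp only: cesaro3_matrix_eq cesaro3_weight_def[of \<alpha> "j - r"] h_def times_divide_eq_right mult.assoc)
  qed
  from this[of 0] this[of 1] this[of 2] this[of 3]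
  have "cesaro3_right \<alpha> i j = (h a - 3 * h (a - 1) + 3 * h (a - 2) - h (a - 3)) / 6 / cesaro3_weight \<alpha> i"
    using j by (simp add: cesaro3_right_def third_diff_def numeral_2_eq_2 diff_divide_distrib add_divide_distrib)
  also have "\<dots> = (30 * (a * (a + 1)) - 24 * (w * a) - 96 * a + 3 * (w * w) + 21 * w + 36) / cesaro3_weight \<alpha> i"
    unfolding h_def third_diff_row ..
  finally have eq: "cesaro3_right \<alpha> i j = \<dots>" .
  have "\<bar>a * (a + 1)\<bar> \<le> b * (2 * b)" by (rule abs_mult_le) (use b in auto)
  \<comment> \<open>In multiples of \<open>b * b\<close> the terms add up to 60 + 48 + 96 + 12 + 42
    + 36 = 294, using \<open>\<bar>w\<bar> \<le> 2 * b\<close>.\<close>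
  then have "\<bar>30 * (a * (a + 1)) - 24 * (w * a) - 96 * a + 3 * (w * w) + 21 * w + 36\<bar> \<le> 300 * (b * b)"
    using abs_mult_le[OF b(3,2)] abs_mult_le[OF b(3,3)] b bb unfolding abs_le_iff by (intro conjI; linarith)
  then have "\<bar>cesaro3_right \<alpha> i j\<bar> \<le> 300 * (b * b) / (c * n * n * n)"
    unfolding eq abs_divide using n c D by (intro frac_le) auto
  also have "\<dots> = 300 * (1 + \<bar>\<alpha>\<bar>)\<^sup>2 / c / n"
    using n c by (simp add: b_def power2_eq_square field_simps)
  finally show ?thesis by (simp add: n_def c_def)
qed

lemma cesaro3_right_eq_0: "i + 3 < j \<Longrightarrow> cesaro3_right \<alpha> i j = 0"
  by (simp add: cesaro3_right_def third_diff_def cesaro3_matrix_eq_0)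

section \<open>The bounded operators \<open>X M\<close> and \<open>M X\<close>, and the two
  factorizations\<close>

lemma ex_cesaro3_left_operator:
  assumes \<alpha>: "\<alpha> > -1"
  obtains B where "bounded_clinear B"
    "\<And>f i. ell2_nth (B f) i
      = complex_of_real (cesaro3_weight \<alpha> i / 6) * third_diff (ell2_nth (cesaro3 \<alpha> f)) i"
proof -
  define K where "K = 90 * (1 + \<bar>\<alpha>\<bar>)\<^sup>2 + 48"
  have lower: "\<bar>cesaro3_left \<alpha> i j\<bar> \<le> K / (real i + 1)" if "j \<le> i" for i j
    using cesaro3_left_lower[OF \<alpha> that] by (rule order_trans) (auto simp: K_def intro: divide_right_mono)
  have upper: "\<bar>cesaro3_left \<alpha> i j\<bar> \<le> K" if "i < j" "j \<le> i + 3" for i j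
    using cesaro3_left_upper[OF \<alpha> that(1)] by (rule order_trans) (simp add: K_def)
  let ?B = "matrix_operator (\<lambda>i j. complex_of_real (cesaro3_left \<alpha> i j))"
  have "bounded_clinear ?B"
    by (rule bounded_clinear_hardy_band[OF lower upper cesaro3_left_eq_0])
  moreover have "ell2_nth (?B f) i = (\<Sum>j\<le>i + 3. complex_of_real (cesaro3_left \<alpha> i j) * ell2_nth f j)" for f i
    by (rule hardy_band_nth[OF lower upper cesaro3_left_eq_0])
  ultimately show thesis by (intro that) (simp_all only: cesaro3_left_sum[OF \<alpha>])
qed

lemma ex_cesaro3_right_operator:
  assumes \<alpha>: "\<alpha> > -1"
  obtains B where "bounded_clinear B"
    "\<And>f i. ell2_nth (B f) i
      = (\<Sum>k\<le>i. complex_of_real (cesaro3_weight \<alpha> k * cesaro3_matrix \<alpha> i k / 6) * third_diff (ell2_nth f) k)"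
proof -
  define K1 K2 where "K1 = 8 * cesaro3_weight \<alpha> 2 / min 1 (1 + \<alpha>)"
    and "K2 = 300 * (1 + \<bar>\<alpha>\<bar>)\<^sup>2 / min 1 (1 + \<alpha>)"
  have K: "0 \<le> K1" "0 \<le> K2"
    using \<alpha> cesaro3_weight_pos[OF \<alpha>, of 2] by (auto simp: K1_def K2_def)
  have lower: "\<bar>cesaro3_right \<alpha> i j\<bar> \<le> (K1 + K2 + 48) / (real i + 1)" if "j \<le> i" for i j
  proof (cases "j \<le> 2")
    case True
    have "\<bar>cesaro3_right \<alpha> i j\<bar> \<le> K1 / (real i + 1)"
      unfolding K1_def by (rule cesaro3_right_boundary[OF \<alpha> True that])
    also have "\<dots> \<le> (K1 + K2 + 48) / (real i + 1)" using K by (intro divide_right_mono) auto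
    finally show ?thesis .
  next
    case False
    then have "\<bar>cesaro3_right \<alpha> i j\<bar> \<le> K2 / (real i + 1)"
      unfolding K2_def by (intro cesaro3_right_interior[OF \<alpha> _ that]) simp
    also have "\<dots> \<le> (K1 + K2 + 48) / (real i + 1)" using K by (intro divide_right_mono) auto
    finally show ?thesis .
  qed
  have upper: "\<bar>cesaro3_right \<alpha> i j\<bar> \<le> K1 + K2 + 48" if "i < j" "j \<le> i + 3" for i j
    using cesaro3_right_upper[OF \<alpha> that(1)] K by linarith
  let ?B = "matrix_operator (\<lambda>i j. complex_of_real (cesaro3_right \<alpha> i j))"
  have "bounded_clinear ?B"
    by (rule bounded_clinear_hardy_band[OF lower upper cesaro3_right_eq_0])
  moreover have "ell2_nth (?B f) i = (\<Sum>j\<le>i + 3. complex_of_real (cesaro3_right \<alpha> i j) * ell2_nth f j)" for f i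
    by (rule hardy_band_nth[OF lower upper cesaro3_right_eq_0])
  ultimately show thesis by (intro that) (simp_all only: cesaro3_right_sum)
qed

theorem corollary2p2:
  fixes \<alpha> :: real
  assumes "\<alpha> > -1"
  shows "posinormal (cesaro3 \<alpha>) \<and> coposinormal (cesaro3 \<alpha>)"
proof
  note M = bounded_clinear_cesaro3[OF assms]
  have w: "cesaro3_weight \<alpha> i \<noteq> 0" for i using cesaro3_weight_pos[OF assms, of i] by simp
  obtain M' where adj: "\<And>x y. cinner (cesaro3 \<alpha> x) y = cinner x (M' y)"
    using ex_adjoint_ell2[OF M] by metis
  note diff = third_diff_adjoint_cesaro3[OF assms adj]
  show "posinormal (cesaro3 \<alpha>)"
  proof -
    obtain B where B: "bounded_clinear B" and nth: "\<And>f i. ell2_nth (B f) i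
        = complex_of_real (cesaro3_weight \<alpha> i / 6) * third_diff (ell2_nth (cesaro3 \<alpha> f)) i"
      using ex_cesaro3_left_operator[OF assms] by metis
    obtain B' where B': "bounded_clinear B'" "\<And>x y. cinner (B x) y = cinner x (B' y)"
      using ex_adjoint_ell2[OF B] by metis
    \<comment> \<open>After differencing, the factor \<open>6 / cesaro3_weight \<alpha> i\<close>
      from \<open>M'\<close> cancels the one in \<open>B\<close>.\<close>
    have "cesaro3 \<alpha> f = M' (B f)" for f
      by (rule ell2_eqI_third_diff) (use w in \<open>simp add: diff nth\<close>)
    then have "cesaro3 \<alpha> = M' \<circ> B" by auto
    then show ?thesis by (rule posinormal_if_factor[OF M B B'(1) adj B'(2)])
  qed
  show "coposinormal (cesaro3 \<alpha>)"
  proof -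
    obtain B where B: "bounded_clinear B" and nth: "\<And>f i. ell2_nth (B f) i
        = (\<Sum>k\<le>i. complex_of_real (cesaro3_weight \<alpha> k * cesaro3_matrix \<alpha> i k / 6) * third_diff (ell2_nth f) k)"
      using ex_cesaro3_right_operator[OF assms] by metis
    obtain B' where B': "bounded_clinear B'" "\<And>x y. cinner (B x) y = cinner x (B' y)"
      using ex_adjoint_ell2[OF B] by metis
    \<comment> \<open>Here \<open>B\<close> is the operator \<open>E = M X\<close>. Since
      \<open>X\<close> undoes \<open>M'\<close>, the sum for \<open>B (M' f)\<close> collapses to
      row \<open>i\<close> of the matrix applied to \<open>f\<close>.\<close>
    have "cesaro3 \<alpha> f = B (M' f)" for f
      by (rule ell2_eqI) (use w in \<open>simp add: diff nth cesaro3_nth[OF assms]\<close>)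
    then have "cesaro3 \<alpha> = B \<circ> M'" by auto
    then show ?thesis by (rule coposinormal_if_factor[OF M B B'(1) adj B'(2)])
  qed
qed

end
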